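(* Let $(x,a,s)$ be a basic solution of the linear program (LP) described in the context, with a given basis. Let $V_{NB}\subseteq V$ be the set of vertices $v$ for which $x_v$ is nonbasic, let $E^+$ be the set of edges $uv\in E$ for which $a_{uv}$ is nonbasic, let $E^-$ be the set of edges $uv\in E$ for which $a_{vu}$ is nonbasic, let $E_{NB}=E^+\cap E^-$, and let $G_{NB}=(V,E_{NB})$ be the subgraph of $G$ with edge set $E_{NB}$. Let $V=V_1\cup\dots\cup V_k$ be the partition of $V$ into the vertex sets of the connected components of $G_{NB}$ (ignoring edge directions). Then: (1) $E^+\cup E^-=E$. (2) If $s$ is basic, then $|V_{NB}\cap V_i|=1$ for all $i=1,\dots,k$. If $s$ is nonbasic, then $|V_{NB}\cap V_i|=1$ for all but one index $i$, and for this exceptional index $i$ one has $|V_{NB}\cap V_i|=0$ and $h(V_i)\neq 0$, where $h(V_i)=\sum_{v\in V_i}h_v$. (3) Each connected component of $G_{NB}$ is a tree.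
   Context: Let $G=(V,E)$ be a finite simple directed graph (no loops, and for each pair of vertices at most one of $uv,vu$ is in $E$). Let $c,h\in\mathbb{R}^V$ with $h_v>0$ for all $v$, let $\Delta\in\mathbb{R}$, and for every edge $uv\in E$ let $d_{uv},d_{vu}\in\mathbb{R}$ with $d_{uv}+d_{vu}\ge 0$. (LP) is the linear program in the variables $x_v$ ($v\in V$), $a_{uv},a_{vu}$ (two variables for each edge $uv\in E$) and $s$: $$\min \sum_{v\in V}c_vx_v+\sum_{uv\in E}(d_{uv}a_{uv}+d_{vu}a_{vu})$$ subject to $x_u-x_v=a_{uv}-a_{vu}$ for all $uv\in E$; $\sum_{v\in V}h_vx_v+s=\Delta$; $0\le x_v\le 1$ for $v\in V$; $a_{uv},a_{vu}\ge 0$ for $uv\in E$; $s\ge 0$. There are $|E|+1$ equality constraints and $|V|+2|E|+1$ variables. A basis is a set of $|E|+1$ variables (the basic variables) whose columns in the equality-constraint matrix are linearly independent; the other variables are nonbasic. The associated basic solutions are those solutions of the equality constraints in which every nonbasic variable equals one of its finite bounds: nonbasic $x_v\in\{0,1\}$, nonbasic $a_{uv}$, $a_{vu}$ and $s$ equal $0$. (A basic solution need not satisfy the bounds on the basic variables.) *)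

theory Defs
  imports
    "HOL-Library.Extended_Real"
    "HOL-Library.Function_Algebras"
    "Graph_Theory.Digraph_Component"
begin

section \<open>Linear programs with equality constraints and bounded variables\<close>

interpretation real_fun: vector_space "\<lambda>(c::real) (f::'i \<Rightarrow> real) i. c * f i"
  by unfold_locales (auto simp: algebra_simps)

text \<open>
  Minimise \<open>\<Sum>j. cost j * z j\<close> subject to \<open>\<Sum>j. coef i j * z j = rhs i\<close> for every row \<open>i\<close>
  and \<open>lower j \<le> z j \<le> upper j\<close> for every variable \<open>j\<close>.
\<close>

record ('i, 'j) lp =
  lp_rows :: "'i set"
  lp_vars :: "'j set"
  lp_coef :: "'i \<Rightarrow> 'j \<Rightarrow> real"
  lp_rhs :: "'i \<Rightarrow> real"
  lp_cost :: "'j \<Rightarrow> real"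
  lp_lower :: "'j \<Rightarrow> ereal"
  lp_upper :: "'j \<Rightarrow> ereal"

definition lp_objective :: "('i, 'j) lp \<Rightarrow> ('j \<Rightarrow> real) \<Rightarrow> real" where
  "lp_objective P z = (\<Sum>j\<in>lp_vars P. lp_cost P j * z j)"

definition lp_equations :: "('i, 'j) lp \<Rightarrow> ('j \<Rightarrow> real) \<Rightarrow> bool" where
  "lp_equations P z \<longleftrightarrow> (\<forall>i\<in>lp_rows P. (\<Sum>j\<in>lp_vars P. lp_coef P i j * z j) = lp_rhs P i)"

definition lp_feasible :: "('i, 'j) lp \<Rightarrow> ('j \<Rightarrow> real) \<Rightarrow> bool" where
  "lp_feasible P z \<longleftrightarrow> lp_equations P z \<and>
     (\<forall>j\<in>lp_vars P. lp_lower P j \<le> ereal (z j) \<and> ereal (z j) \<le> lp_upper P j)"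

definition lp_column :: "('i, 'j) lp \<Rightarrow> 'j \<Rightarrow> 'i \<Rightarrow> real" where
  "lp_column P j = (\<lambda>i. if i \<in> lp_rows P then lp_coef P i j else 0)"

text \<open>
  The columns of a basis are linearly independent as a family; \<^const>\<open>inj_on\<close> rules out
  two basic variables with the same column, which the set of columns would not detect.
\<close>

definition lp_basis :: "('i, 'j) lp \<Rightarrow> 'j set \<Rightarrow> bool" where
  "lp_basis P B \<longleftrightarrow> B \<subseteq> lp_vars P \<and> card B = card (lp_rows P) \<and>
     inj_on (lp_column P) B \<and> real_fun.independent (lp_column P ` B)"

text \<open>Basic variables may violate their bounds. An infinite bound is never attained.\<close>

definition lp_basic_solution :: "('i, 'j) lp \<Rightarrow> 'j set \<Rightarrow> ('j \<Rightarrow> real) \<Rightarrow> bool" where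
  "lp_basic_solution P B z \<longleftrightarrow> lp_basis P B \<and> lp_equations P z \<and>
     (\<forall>j\<in>lp_vars P - B. ereal (z j) = lp_lower P j \<or> ereal (z j) = lp_upper P j)"

lemma sum_fun_apply: "(\<Sum>j\<in>A. f j) i = (\<Sum>j\<in>A. f j i)" for f :: "'j \<Rightarrow> 'i \<Rightarrow> real"
  by (induction A rule: infinite_finite_induct) auto

lemma lp_columns_independent_iff:
  assumes "finite B"
  shows "inj_on (lp_column P) B \<and> real_fun.independent (lp_column P ` B) \<longleftrightarrow>
    (\<forall>f. (\<forall>i\<in>lp_rows P. (\<Sum>j\<in>B. f j * lp_coef P i j) = 0) \<longrightarrow> (\<forall>j\<in>B. f j = 0))"
    (is "?L \<longleftrightarrow> ?R")
proof
  have col: "lp_column P j i = lp_coef P i j" if "i \<in> lp_rows P" for i j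
    using that by (simp add: lp_column_def)
  assume R: ?R
  have inj: "inj_on (lp_column P) B"
  proof (rule inj_onI, rule ccontr)
    fix j k assume jk: "j \<in> B" "k \<in> B" "lp_column P j = lp_column P k" "j \<noteq> k"
    let ?f = "\<lambda>l. (if l = j then 1 else 0) - (if l = k then 1 else 0 :: real)"
    have "(\<Sum>l\<in>B. ?f l * lp_coef P i l) = 0" if "i \<in> lp_rows P" for i
    proof -
      have "(\<Sum>l\<in>B. ?f l * lp_coef P i l) = lp_coef P i j - lp_coef P i k"
        using jk assms
        by (simp add: left_diff_distrib sum_subtractf if_distrib[of "\<lambda>c. c * _"] cong: if_cong)
      then show ?thesis using fun_cong[OF jk(3), of i] that by (simp add: lp_column_def)
    qed
    then have "\<forall>l\<in>B. ?f l = 0" by (intro mp[OF spec[OF R, of ?f]] ballI)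
    then have "?f j = 0" using jk(1) by (rule bspec)
    with jk(4) show False by simp
  qed
  moreover have "real_fun.independent (lp_column P ` B)"
  proof
    assume "real_fun.dependent (lp_column P ` B)"
    then obtain u where u: "\<exists>w\<in>lp_column P ` B. u w \<noteq> 0"
        "(\<Sum>w\<in>lp_column P ` B. (\<lambda>i. u w * w i)) = 0"
      using assms by (auto simp: real_fun.dependent_finite)
    from u(2) have "(\<Sum>j\<in>B. (\<lambda>i. u (lp_column P j) * lp_column P j i)) = 0"
      by (simp add: sum.reindex[OF inj])
    then have "(\<Sum>j\<in>B. u (lp_column P j) * lp_column P j i) = 0" for i
      unfolding fun_eq_iff sum_fun_apply by simp
    then have "\<forall>i\<in>lp_rows P. (\<Sum>j\<in>B. u (lp_column P j) * lp_coef P i j) = 0"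
      by (simp add: col[symmetric])
    then have "\<forall>j\<in>B. u (lp_column P j) = 0" by (rule mp[OF spec[OF R]])
    with u(1) show False by blast
  qed
  ultimately show ?L ..
next
  assume L: ?L
  then have inj: "inj_on (lp_column P) B" and ind: "real_fun.independent (lp_column P ` B)"
    by simp_all
  show ?R
  proof (intro allI impI)
    fix f assume f: "\<forall>i\<in>lp_rows P. (\<Sum>j\<in>B. f j * lp_coef P i j) = 0"
    define u where "u w = f (the_inv_into B (lp_column P) w)" for w
    have u: "u (lp_column P j) = f j" if "j \<in> B" for j
      using the_inv_into_f_f[OF inj that] by (simp add: u_def)
    have "(\<Sum>w\<in>lp_column P ` B. (\<lambda>i. u w * w i)) = (\<Sum>j\<in>B. (\<lambda>i. f j * lp_column P j i))"
      unfolding sum.reindex[OF inj] by (rule sum.cong) (simp_all add: u)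
    also have "\<dots> = 0"
    proof
      fix i
      show "(\<Sum>j\<in>B. (\<lambda>i. f j * lp_column P j i)) i = 0 i"
        using f by (cases "i \<in> lp_rows P") (simp_all add: sum_fun_apply lp_column_def)
    qed
    finally have sum0: "(\<Sum>w\<in>lp_column P ` B. (\<lambda>i. u w * w i)) = 0" .
    have "\<forall>w\<in>lp_column P ` B. u w = 0"
    proof (rule ccontr)
      assume "\<not> (\<forall>w\<in>lp_column P ` B. u w = 0)"
      then have "\<exists>w\<in>lp_column P ` B. u w \<noteq> 0" by simp
      with sum0 have "real_fun.dependent (lp_column P ` B)"
        unfolding real_fun.dependent_finite[OF finite_imageI[OF assms]]
        by (intro exI[of _ u] conjI)
      with ind show False by contradiction
    qed
    then show "\<forall>j\<in>B. f j = 0" by (simp add: u)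
  qed
qed


section \<open>The linear program of a simple directed graph\<close>

datatype 'v flow_var = XVar 'v | AVar 'v 'v | SVar

datatype 'v flow_row = EdgeRow 'v 'v | BudgetRow

text \<open>
  \<^term>\<open>EdgeRow u v\<close> is the constraint \<open>x u - x v - a u v + a v u = 0\<close>;
  \<^term>\<open>BudgetRow\<close> is \<open>\<Sum>v. h v * x v + s = \<Delta>\<close>.
\<close>

fun flow_coef :: "('v \<Rightarrow> real) \<Rightarrow> 'v flow_row \<Rightarrow> 'v flow_var \<Rightarrow> real" where
  "flow_coef h (EdgeRow u v) (XVar w) = of_bool (w = u) - of_bool (w = v)"
| "flow_coef h (EdgeRow u v) (AVar p q) =
     of_bool (p = v \<and> q = u) - of_bool (p = u \<and> q = v)"
| "flow_coef h (EdgeRow u v) SVar = 0"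
| "flow_coef h BudgetRow (XVar w) = h w"
| "flow_coef h BudgetRow (AVar p q) = 0"
| "flow_coef h BudgetRow SVar = 1"

definition flow_lp :: "'v pair_pre_digraph \<Rightarrow> ('v \<Rightarrow> real) \<Rightarrow> ('v \<Rightarrow> real) \<Rightarrow> real \<Rightarrow>
    ('v \<Rightarrow> 'v \<Rightarrow> real) \<Rightarrow> ('v flow_row, 'v flow_var) lp" where
  "flow_lp G c h \<Delta> d =
     \<lparr> lp_rows = {EdgeRow u v | u v. (u, v) \<in> parcs G} \<union> {BudgetRow},
       lp_vars = XVar ` pverts G \<union>
         {AVar u v | u v. (u, v) \<in> parcs G \<or> (v, u) \<in> parcs G} \<union> {SVar},
       lp_coef = flow_coef h,
       lp_rhs = case_flow_row (\<lambda>_ _. 0) \<Delta>,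
       lp_cost = case_flow_var c d 0,
       lp_lower = (\<lambda>_. 0),
       lp_upper = case_flow_var (\<lambda>_. 1) (\<lambda>_ _. \<infinity>) \<infinity> \<rparr>"

definition simple_digraph :: "'v pair_pre_digraph \<Rightarrow> bool" where
  "simple_digraph G \<longleftrightarrow> pair_digraph G \<and> (\<forall>u v. (u, v) \<in> parcs G \<longrightarrow> (v, u) \<notin> parcs G)"

lemma sum_flow_vars:
  fixes F :: "'v flow_var \<Rightarrow> real"
  assumes "simple_digraph G"
  shows "(\<Sum>j\<in>lp_vars (flow_lp G c h \<Delta> d). F j) =
    (\<Sum>v\<in>pverts G. F (XVar v)) + (\<Sum>(u, v)\<in>parcs G. F (AVar u v) + F (AVar v u)) + F SVar"
proof -
  interpret pair_digraph G using assms by (simp add: simple_digraph_def)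
  let ?A = "(\<lambda>(u, v). AVar u v) ` parcs G" and ?A' = "(\<lambda>(u, v). AVar v u) ` parcs G"
  have vars: "lp_vars (flow_lp G c h \<Delta> d) = (XVar ` pverts G \<union> (?A \<union> ?A')) \<union> {SVar}"
    by (auto simp: flow_lp_def image_iff)
  have fin: "finite (pverts G)" "finite (parcs G)"
    by (simp_all add: pair_finite_verts pair_finite_arcs)
  have disj: "?A \<inter> ?A' = {}" using assms by (auto simp: simple_digraph_def)
  have "(\<Sum>j\<in>?A. F j) + (\<Sum>j\<in>?A'. F j) = (\<Sum>(u, v)\<in>parcs G. F (AVar u v) + F (AVar v u))"
    by (subst (1 2) sum.reindex) (auto simp: inj_on_def sum.distrib case_prod_beta)
  then have A: "(\<Sum>j\<in>?A \<union> ?A'. F j) = (\<Sum>(u, v)\<in>parcs G. F (AVar u v) + F (AVar v u))"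
    using fin disj by (subst sum.union_disjoint) auto
  have X: "(\<Sum>j\<in>XVar ` pverts G. F j) = (\<Sum>v\<in>pverts G. F (XVar v))"
    by (subst sum.reindex) (auto simp: inj_on_def)
  have "(\<Sum>j\<in>XVar ` pverts G \<union> (?A \<union> ?A'). F j) =
      (\<Sum>v\<in>pverts G. F (XVar v)) + (\<Sum>(u, v)\<in>parcs G. F (AVar u v) + F (AVar v u))"
    unfolding A[symmetric] X[symmetric] using fin by (intro sum.union_disjoint) auto
  moreover have "(\<Sum>j\<in>(XVar ` pverts G \<union> (?A \<union> ?A')) \<union> {SVar}. F j) =
      (\<Sum>j\<in>XVar ` pverts G \<union> (?A \<union> ?A'). F j) + F SVar"
    using fin by (subst sum.union_disjoint) auto
  ultimately show ?thesis unfolding vars by simp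
qed

lemma lp_equations_flow_lp:
  assumes "simple_digraph G"
  shows "lp_equations (flow_lp G c h \<Delta> d) (case_flow_var x a s) \<longleftrightarrow>
    (\<forall>(u, v)\<in>parcs G. x u - x v = a u v - a v u) \<and> (\<Sum>v\<in>pverts G. h v * x v) + s = \<Delta>"
proof -
  interpret pair_digraph G using assms by (simp add: simple_digraph_def)
  let ?P = "flow_lp G c h \<Delta> d" and ?z = "case_flow_var x a s"
  have edge: "(\<Sum>j\<in>lp_vars ?P. lp_coef ?P (EdgeRow u v) j * ?z j) = x u - x v - a u v + a v u"
    if uv: "(u, v) \<in> parcs G" for u v
  proof -
    have mem: "u \<in> pverts G" "v \<in> pverts G" using uv by (auto dest: in_arcsD1 in_arcsD2)
    have nuv: "(v, u) \<notin> parcs G" "u \<noteq> v" using assms uv by (auto simp: simple_digraph_def)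
    have "(\<Sum>w\<in>pverts G. (of_bool (w = u) - of_bool (w = v)) * x w) = x u - x v"
      using mem pair_finite_verts by (simp add: left_diff_distrib sum_subtractf of_bool_def
        if_distrib[of "\<lambda>c. c * _"] cong: if_cong)
    moreover have "(\<Sum>(p, q)\<in>parcs G. (of_bool (p = v \<and> q = u) - of_bool (p = u \<and> q = v)) * a p q +
        (of_bool (q = v \<and> p = u) - of_bool (q = u \<and> p = v)) * a q p) =
        (\<Sum>e\<in>parcs G. if e = (u, v) then a v u - a u v else 0)"
      using nuv by (intro sum.cong refl) (force split: prod.splits if_splits simp: of_bool_def)
    ultimately show ?thesis
      using uv pair_finite_arcs by (simp add: sum_flow_vars[OF assms]) (simp add: flow_lp_def)
  qed
  have budget: "(\<Sum>j\<in>lp_vars ?P. lp_coef ?P BudgetRow j * ?z j) = (\<Sum>v\<in>pverts G. h v * x v) + s"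
    by (simp add: sum_flow_vars[OF assms]) (simp add: flow_lp_def)
  have rows: "lp_rows ?P = {EdgeRow u v | u v. (u, v) \<in> parcs G} \<union> {BudgetRow}"
    and rhs: "lp_rhs ?P (EdgeRow u v) = 0" "lp_rhs ?P BudgetRow = \<Delta>" for u v
    by (simp_all add: flow_lp_def)
  have "lp_equations ?P ?z \<longleftrightarrow>
      (\<forall>(u, v)\<in>parcs G. (\<Sum>j\<in>lp_vars ?P. lp_coef ?P (EdgeRow u v) j * ?z j) =
        lp_rhs ?P (EdgeRow u v)) \<and>
      (\<Sum>j\<in>lp_vars ?P. lp_coef ?P BudgetRow j * ?z j) = lp_rhs ?P BudgetRow"
    unfolding lp_equations_def rows by blast
  also have "\<dots> \<longleftrightarrow> (\<forall>(u, v)\<in>parcs G. x u - x v - a u v + a v u = 0) \<and>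
      (\<Sum>v\<in>pverts G. h v * x v) + s = \<Delta>"
    unfolding budget rhs by (intro arg_cong2[of _ _ _ _ "(\<and>)"] ball_cong refl) (auto simp only: edge)
  finally show ?thesis by (simp add: algebra_simps)
qed

lemma lp_feasible_flow_lp:
  assumes "simple_digraph G"
  shows "lp_feasible (flow_lp G c h \<Delta> d) (case_flow_var x a s) \<longleftrightarrow>
    (\<forall>(u, v)\<in>parcs G. x u - x v = a u v - a v u) \<and> (\<Sum>v\<in>pverts G. h v * x v) + s = \<Delta> \<and>
    (\<forall>v\<in>pverts G. 0 \<le> x v \<and> x v \<le> 1) \<and> (\<forall>(u, v)\<in>parcs G. 0 \<le> a u v \<and> 0 \<le> a v u) \<and> 0 \<le> s"
proof -
  have "(\<forall>j\<in>lp_vars (flow_lp G c h \<Delta> d).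
      lp_lower (flow_lp G c h \<Delta> d) j \<le> ereal (case_flow_var x a s j) \<and>
      ereal (case_flow_var x a s j) \<le> lp_upper (flow_lp G c h \<Delta> d) j) \<longleftrightarrow>
    (\<forall>v\<in>pverts G. 0 \<le> x v \<and> x v \<le> 1) \<and> (\<forall>(u, v)\<in>parcs G. 0 \<le> a u v \<and> 0 \<le> a v u) \<and> 0 \<le> s"
  proof -
    have split: "(\<forall>j\<in>lp_vars (flow_lp G c h \<Delta> d). Q j) \<longleftrightarrow>
        (\<forall>v\<in>pverts G. Q (XVar v)) \<and> (\<forall>(u, v)\<in>parcs G. Q (AVar u v) \<and> Q (AVar v u)) \<and> Q SVar"
      for Q :: "'a flow_var \<Rightarrow> bool"
      unfolding flow_lp_def lp.simps by blast
    show ?thesis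
      unfolding split by (simp add: flow_lp_def zero_ereal_def one_ereal_def)
  qed
  then show ?thesis
    by (simp only: lp_feasible_def lp_equations_flow_lp[OF assms] conj_assoc)
qed

lemma lp_objective_flow_lp:
  assumes "simple_digraph G"
  shows "lp_objective (flow_lp G c h \<Delta> d) (case_flow_var x a s) =
    (\<Sum>v\<in>pverts G. c v * x v) + (\<Sum>(u, v)\<in>parcs G. d u v * a u v + d v u * a v u)"
  unfolding lp_objective_def sum_flow_vars[OF assms] by (simp add: flow_lp_def)

lemma card_flow_lp:
  assumes "simple_digraph G"
  shows "card (lp_rows (flow_lp G c h \<Delta> d)) = card (parcs G) + 1"
    and "card (lp_vars (flow_lp G c h \<Delta> d)) = card (pverts G) + 2 * card (parcs G) + 1"
proof -
  interpret pair_digraph G using assms by (simp add: simple_digraph_def)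
  have "lp_rows (flow_lp G c h \<Delta> d) = insert BudgetRow ((\<lambda>(u, v). EdgeRow u v) ` parcs G)"
    by (auto simp: flow_lp_def)
  moreover have "card ((\<lambda>(u, v). EdgeRow u v) ` parcs G) = card (parcs G)"
    by (rule card_image) (auto simp: inj_on_def)
  moreover have "BudgetRow \<notin> (\<lambda>(u, v). EdgeRow u v) ` parcs G" by auto
  ultimately show "card (lp_rows (flow_lp G c h \<Delta> d)) = card (parcs G) + 1"
    using pair_finite_arcs by simp
  show "card (lp_vars (flow_lp G c h \<Delta> d)) = card (pverts G) + 2 * card (parcs G) + 1"
    using sum_flow_vars[OF assms, of "\<lambda>_. 1" c h \<Delta> d] by simp
qed


section \<open>The subgraph determined by the nonbasic variables\<close>

definition nonbasic_verts :: "'v pair_pre_digraph \<Rightarrow> 'v flow_var set \<Rightarrow> 'v set" where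
  "nonbasic_verts G B = {v \<in> pverts G. XVar v \<notin> B}"

definition nonbasic_pos :: "'v pair_pre_digraph \<Rightarrow> 'v flow_var set \<Rightarrow> ('v \<times> 'v) set" where
  "nonbasic_pos G B = {(u, v) \<in> parcs G. AVar u v \<notin> B}"

definition nonbasic_neg :: "'v pair_pre_digraph \<Rightarrow> 'v flow_var set \<Rightarrow> ('v \<times> 'v) set" where
  "nonbasic_neg G B = {(u, v) \<in> parcs G. AVar v u \<notin> B}"

definition nonbasic_graph :: "'v pair_pre_digraph \<Rightarrow> 'v flow_var set \<Rightarrow> 'v pair_pre_digraph" where
  "nonbasic_graph G B =
     \<lparr> pverts = pverts G, parcs = nonbasic_pos G B \<inter> nonbasic_neg G B \<rparr>"


section \<open>Components and trees, ignoring edge directions\<close>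

text \<open>Maximal connected subgraphs; \<^const>\<open>connected\<close> ignores directions and excludes the empty graph.\<close>

definition components :: "('a, 'b) pre_digraph \<Rightarrow> ('a, 'b) pre_digraph set" where
  "components G = {H. pre_digraph.max_subgraph G connected H}"

text \<open>
  \<^const>\<open>tree\<close> only forbids directed cycles, hence is not used here. In the symmetric graph
  every edge yields a closed walk of length two, so cycles have length at least three. This
  is adequate for graphs without loops and with at most one arc between any two vertices.
\<close>

definition undirected_tree :: "('a, 'b) pre_digraph \<Rightarrow> bool" where
  "undirected_tree G \<longleftrightarrow> connected G \<and>
     (\<nexists>p. pre_digraph.cycle (with_proj (mk_symmetric G)) p \<and> 3 \<le> length p)"

end

theory Submission
  imports Defs
begin

text \<open>
  Linear independence of the basic columns means that a solution of the homogeneous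
  equations that vanishes on all nonbasic variables is zero (\<open>lp_basis_kernel\<close>).

  If \<open>a\<^sub>u\<^sub>v\<close> and \<open>a\<^sub>v\<^sub>u\<close> were both basic, putting both to \<open>1\<close> would be such a solution
  that is not zero. So every edge has a nonbasic variable, and every edge outside \<open>E\<^sub>N\<^sub>B\<close> has
  exactly one basic variable, which can absorb any difference \<open>x\<^sub>u - x\<^sub>v\<close>. A vector \<open>x\<close> that is constant on the components of \<open>G\<^sub>N\<^sub>B\<close> and
  zero on \<open>V\<^sub>N\<^sub>B\<close> therefore extends to a homogeneous solution, as soon as \<open>s\<close> is basic or
  \<open>\<Sum>\<^sub>v h\<^sub>v x\<^sub>v = 0\<close>, and must be zero (\<open>flow_basis_potential\<close>). Call a component free if it
  does not meet \<open>V\<^sub>N\<^sub>B\<close>. If \<open>s\<close> is basic, the indicator of a free component is such a vector,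
  so there is none. If \<open>s\<close> is nonbasic, two free components \<open>S\<close> and \<open>T\<close> would give the vector
  that is \<open>h(T)\<close> on \<open>S\<close> and \<open>- h(S)\<close> on \<open>T\<close>, so there is at most one.

  The rest is counting. Let \<open>\<sigma>\<close> be \<open>1\<close> if \<open>s\<close> is basic and \<open>0\<close> otherwise, and \<open>k\<close> the number
  of components. Since a basis has \<open>|E| + 1\<close> elements,
  \<open>|V| + \<sigma> = |V\<^sub>N\<^sub>B| + |E\<^sub>N\<^sub>B| + 1\<close> (\<open>flow_basis_card\<close>). A graph with \<open>k\<close> components satisfies
  \<open>|V| \<le> k + |E\<^sub>N\<^sub>B|\<close>, so \<open>|V\<^sub>N\<^sub>B| \<le> k - (1 - \<sigma>)\<close>. As at most \<open>1 - \<sigma>\<close> components are free, also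
  \<open>|V\<^sub>N\<^sub>B| \<ge> k - (1 - \<sigma>)\<close>. So there are exactly \<open>1 - \<sigma>\<close> free components, all others meet
  \<open>V\<^sub>N\<^sub>B\<close> once, and \<open>|V| = k + |E\<^sub>N\<^sub>B|\<close>. The last equality fails if \<open>G\<^sub>N\<^sub>B\<close> contains
  a cycle, because deleting an edge of a cycle keeps the components
  (\<open>card_less_if_redundant_arc\<close>, \<open>cycle_imp_redundant_arc\<close>). Hence the components are trees.
\<close>

section \<open>Counting the classes of the equivalence relation generated by a set of arcs\<close>

definition linked :: "('a \<times> 'a) set \<Rightarrow> ('a \<times> 'a) set" where
  "linked E = (E \<union> E\<inverse>)\<^sup>*"

lemma linked_mono: "E \<subseteq> F \<Longrightarrow> linked E \<subseteq> linked F"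
  unfolding linked_def by (intro rtrancl_mono) auto

lemma equiv_linked: "equiv UNIV (linked E)"
  unfolding linked_def
  by (intro equivI refl_rtrancl trans_rtrancl sym_rtrancl) (auto simp: sym_def)

lemma linked_refl: "(x, x) \<in> linked E"
  by (simp add: linked_def)

lemma linked_sym: "(x, y) \<in> linked E \<Longrightarrow> (y, x) \<in> linked E"
  using equiv_linked[of E] by (auto elim!: equivE dest: symD)

lemma linked_trans: "(x, y) \<in> linked E \<Longrightarrow> (y, z) \<in> linked E \<Longrightarrow> (x, z) \<in> linked E"
  unfolding linked_def by (rule rtrancl_trans)

lemma linked_arc: "(x, y) \<in> E \<Longrightarrow> (x, y) \<in> linked E"
  by (auto simp: linked_def)

lemma linked_class_eq_iff: "linked E `` {v} = linked E `` {w} \<longleftrightarrow> (v, w) \<in> linked E"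
  by (rule eq_equiv_class_iff[OF equiv_linked]) simp_all

lemma linked_class_of_member:
  assumes "S \<in> V // linked E" "v \<in> S"
  shows "S = linked E `` {v}"
  using assms by (auto elim!: quotientE simp: linked_class_eq_iff intro: linked_trans linked_sym)

lemma linked_closed:
  assumes "E \<subseteq> V \<times> V" "v \<in> V" "(v, w) \<in> linked E"
  shows "w \<in> V"
  using assms(3) unfolding linked_def by (induction rule: rtrancl_induct) (use assms(1,2) in auto)

lemma linked_class_subset:
  assumes "E \<subseteq> V \<times> V" "S \<in> V // linked E"
  shows "S \<subseteq> V"
  using assms by (auto elim!: quotientE intro: linked_closed)

lemma linked_class_nonempty: "S \<in> V // linked E \<Longrightarrow> S \<noteq> {}"
  by (auto elim!: quotientE intro: linked_refl)

lemma linked_class_closed: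
  assumes "S \<in> V // linked E" "(u, v) \<in> E"
  shows "u \<in> S \<longleftrightarrow> v \<in> S"
  using linked_arc[OF assms(2)] linked_sym[OF linked_arc[OF assms(2)]] assms(1)
  by (auto elim!: quotientE intro: linked_trans)

lemma linked_classes_disjoint:
  assumes "S \<in> V // linked E" "T \<in> V // linked E" "S \<noteq> T"
  shows "S \<inter> T = {}"
  using linked_class_of_member[OF assms(1)] linked_class_of_member[OF assms(2)] assms(3) by blast

lemma linked_insertD:
  assumes "(x, y) \<in> linked (insert (p, q) E)"
  shows "(x, y) \<in> linked E \<or> (x, p) \<in> linked E \<and> (q, y) \<in> linked E
    \<or> (x, q) \<in> linked E \<and> (p, y) \<in> linked E"
  using assms unfolding linked_def[of "insert _ _"]
proof (induction rule: rtrancl_induct)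
  case base
  show ?case by (simp add: linked_refl)
next
  case (step y z)
  have "(y, z) \<in> linked E \<or> y = p \<and> z = q \<or> y = q \<and> z = p"
    using step.hyps(2) by (auto intro: linked_arc linked_sym)
  with step.IH show ?case by (metis linked_refl linked_trans linked_sym)
qed

text \<open>
  A new arc \<open>(p, q)\<close> can only merge the class of \<open>p\<close> with that of \<open>q\<close>. Away from the class
  of \<open>q\<close> the map from old classes to new ones is therefore injective.
\<close>

lemma card_linked_classes_insert:
  assumes "finite V"
  shows "card (V // linked E) \<le> card (V // linked (insert (p, q) E)) + 1"
proof -
  let ?F = "insert (p, q) E" and ?Q = "V // linked E" and ?q = "linked E `` {q}"
  have EF: "linked E \<subseteq> linked ?F" by (rule linked_mono) auto
  have image: "linked ?F `` (linked E `` {v}) = linked ?F `` {v}" for v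
    using EF by (auto intro: linked_trans linked_refl)
  have fin: "finite ?Q" "finite (V // linked ?F)"
    using assms by (simp_all add: quotient_def)
  have "inj_on ((``) (linked ?F)) (?Q - {?q})"
  proof (rule inj_onI)
    fix X Y
    assume XY: "X \<in> ?Q - {?q}" "Y \<in> ?Q - {?q}" and eq: "linked ?F `` X = linked ?F `` Y"
    from XY obtain v w where vw: "X = linked E `` {v}" "Y = linked E `` {w}"
      by (auto elim!: quotientE)
    from eq have "(v, w) \<in> linked ?F"
      by (simp add: vw image linked_class_eq_iff)
    moreover have "(v, q) \<notin> linked E" "(q, w) \<notin> linked E"
      using XY vw linked_class_eq_iff[of E] linked_sym[of _ _ E] by blast+
    ultimately show "X = Y"
      unfolding vw linked_class_eq_iff by (auto dest: linked_insertD)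
  qed
  moreover have "(``) (linked ?F) ` (?Q - {?q}) \<subseteq> V // linked ?F"
    by (auto elim!: quotientE simp: image intro: quotientI)
  ultimately have "card (?Q - {?q}) \<le> card (V // linked ?F)"
    using fin(2) by (metis card_inj_on_le)
  then show ?thesis
    using fin(1) by (cases "?q \<in> ?Q") (simp_all add: card_Diff_singleton)
qed

lemma card_le_linked_classes_plus_arcs:
  assumes "finite V" "finite E"
  shows "card V \<le> card (V // linked E) + card E"
  using assms(2)
proof (induction E)
  case empty
  have "V // linked {} = (\<lambda>v. {v}) ` V"
    by (auto simp: quotient_def linked_def)
  then show ?case by (simp add: card_image)
next
  case (insert e E)
  then show ?case
    using card_linked_classes_insert[OF assms(1), of E "fst e" "snd e"] by simp
qed

text \<open>
  An arc whose ends stay linked without it can be deleted without changing the classes, so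
  the bound is attained only if there is no such arc.
\<close>

lemma card_less_if_redundant_arc:
  assumes "finite V" "finite E" "(p, q) \<in> E" "(p, q) \<in> linked (E - {(p, q)})"
  shows "card V < card (V // linked E) + card E"
proof -
  let ?D = "E - {(p, q)}"
  have "(x, y) \<in> linked ?D" if "(x, y) \<in> linked E" for x y
  proof -
    have "(x, y) \<in> linked (insert (p, q) ?D)"
      using that assms(3) by (simp add: insert_absorb)
    then show ?thesis
      using assms(4) by (metis linked_insertD linked_sym linked_trans)
  qed
  moreover have "linked ?D \<subseteq> linked E" by (rule linked_mono) auto
  ultimately have "linked E = linked ?D" by auto
  moreover have "card ?D < card E"
    using assms(2,3) by (rule card_Diff1_less)
  ultimately show ?thesis
    using card_le_linked_classes_plus_arcs[OF assms(1), of ?D] assms(2) by simp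
qed

section \<open>Components and cycles in terms of linked vertices\<close>

lemma linked_conv_symcl: "linked E = (symcl E)\<^sup>*"
  unfolding linked_def symcl_def by (rule arg_cong[of _ _ rtrancl]) auto

lemma arcs_ends_with_proj [simp]: "arcs_ends (with_proj N) = parcs N"
  by (auto simp: arcs_ends_conv image_iff)

lemma connected_subgraph_linked:
  assumes "subgraph H (with_proj N)" "connected H" "u \<in> verts H" "v \<in> verts H"
  shows "(u, v) \<in> linked (parcs N)"
proof -
  have "(u, v) \<in> rtrancl_on (verts H) (symcl (arcs_ends H))"
    using assms(2-4) by (simp add: connected_conv)
  moreover have "symcl (arcs_ends H) \<subseteq> symcl (parcs N)"
    using arcs_ends_mono[OF assms(1)] by (auto simp: symcl_def)
  ultimately show ?thesis
    unfolding linked_conv_symcl by (metis rtrancl_on_rtranclI rtrancl_mono subsetD)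
qed

lemma connected_induce_linked_class:
  assumes "pair_wf_digraph N" "S \<in> pverts N // linked (parcs N)"
  shows "connected (with_proj N \<restriction> S)"
proof -
  let ?H = "with_proj N \<restriction> S"
  have "(u, v) \<in> rtrancl_on S (symcl (arcs_ends ?H))" if "u \<in> S" "v \<in> S" for u v
  proof -
    have "(u, v) \<in> linked (parcs N)"
      using that linked_class_of_member[OF assms(2)] by blast
    then have "(u, v) \<in> (parcs N \<union> (parcs N)\<inverse>)\<^sup>*" by (simp add: linked_def)
    then show ?thesis
    proof (induction rule: rtrancl_induct)
      case base
      show ?case using that by auto
    next
      case (step y z)
      have y: "y \<in> S" using step.IH by (rule in_rtrancl_on_in_F)
      with step.hyps(2) have z: "z \<in> S"
        using linked_class_closed[OF assms(2)] by auto
      have "(y, z) \<in> symcl (arcs_ends ?H)"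
        using step.hyps(2) y z by (auto simp: symcl_def arcs_ends_conv image_iff)
      with step.IH z show ?case by (auto intro: rtrancl_on_into_rtrancl_on)
    qed
  qed
  then show ?thesis
    using linked_class_nonempty[OF assms(2)] by (simp add: connected_conv)
qed

lemma subgraph_antisym:
  assumes "subgraph H K" "subgraph K H"
  shows "H = K"
  using assms by (auto intro!: pre_digraph.equality simp: subgraph_def compatible_def)

text \<open>
  Maximality of a component rules out both missing vertices and missing arcs, so it is the
  whole induced subgraph on its class. This lets components be counted and compared as sets
  of vertices.
\<close>

lemma components_conv_linked_classes:
  assumes "pair_wf_digraph N"
  shows "components (with_proj N) = (\<lambda>S. with_proj N \<restriction> S) ` (pverts N // linked (parcs N))"
proof -
  interpret N: pair_wf_digraph N by fact
  let ?E = "parcs N" and ?ind = "\<lambda>S. with_proj N \<restriction> S"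
  have E: "?E \<subseteq> pverts N \<times> pverts N"
    using N.wellformed by fastforce
  have into_class: "subgraph H (?ind (linked ?E `` {u}))"
    if H: "subgraph H (with_proj N)" "connected H" "u \<in> verts H" for H u
    using H(1) connected_subgraph_linked[OF H]
    by (auto simp: subgraph_def compatible_def dest: wf_digraph.wellformed)
  have induced: "subgraph (?ind S) (with_proj N)" "connected (?ind S)"
    if "S \<in> pverts N // linked ?E" for S
    using linked_class_subset[OF E that] connected_induce_linked_class[OF assms that]
    by (simp_all add: N.subgraph_induce_subgraphI)
  have "N.max_subgraph connected C"
    if S: "S \<in> pverts N // linked ?E" and C: "C = ?ind S" for S C
  proof (rule N.max_subgraphI)
    show "connected C" "subgraph C (with_proj N)" using induced[OF S] by (simp_all add: C)
    fix H assume H: "C \<noteq> H" "subgraph C H" "subgraph H (with_proj N)"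
    show "\<not> connected H"
    proof
      assume conn: "connected H"
      obtain u where u: "u \<in> S" using linked_class_nonempty[OF S] by blast
      then have "u \<in> verts H" using subgraph_imp_subverts[OF H(2)] by (auto simp: C)
      from into_class[OF H(3) conn this] have "subgraph H C"
        using linked_class_of_member[OF S u] by (simp add: C)
      with H(1,2) show False by (auto dest: subgraph_antisym)
    qed
  qed
  moreover have "C \<in> ?ind ` (pverts N // linked ?E)" if C: "N.max_subgraph connected C" for C
  proof -
    have sub: "subgraph C (with_proj N)" and conn: "connected C"
      using C by (simp_all add: N.max_subgraph_def)
    from conn obtain u where u: "u \<in> verts C" by (auto simp: connected_conv)
    let ?S = "linked ?E `` {u}"
    have S: "?S \<in> pverts N // linked ?E"
      using u subgraph_imp_subverts[OF sub] by (auto intro!: quotientI)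
    have "?ind ?S = C"
      using C into_class[OF sub conn u] induced[OF S] unfolding N.max_subgraph_def by metis
    then show ?thesis using S by blast
  qed
  ultimately show ?thesis unfolding components_def by blast
qed

lemma cas_with_proj_rtrancl:
  assumes "pre_digraph.cas (with_proj N) u p v" "set p \<subseteq> R"
  shows "(u, v) \<in> R\<^sup>*"
  using assms
  by (induction p arbitrary: u) (auto simp: pre_digraph.cas.simps intro: converse_rtrancl_into_rtrancl)

text \<open>
  The first arc of a cycle of length at least three is bypassed by the rest of the cycle,
  which traverses it in neither direction because the vertices of a cycle are distinct.
\<close>

lemma cycle_imp_redundant_arc:
  assumes wf: "wf_digraph H" and sub: "arcs_ends H \<subseteq> E"
    and cyc: "pre_digraph.cycle (with_proj (mk_symmetric H)) p" and len: "3 \<le> length p"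
  obtains a b where "(a, b) \<in> E" "(a, b) \<in> linked (E - {(a, b)})"
proof -
  interpret H: wf_digraph H by fact
  interpret S: pair_wf_digraph "mk_symmetric H" ..
  obtain a b es where p: "p = (a, b) # es"
    using len by (cases p) auto
  have "parcs (mk_symmetric H) \<subseteq> E \<union> E\<inverse>"
    using sub by (auto simp: parcs_mk_symmetric arcs_ends_conv)
  moreover have "set p \<subseteq> parcs (mk_symmetric H)"
    using cyc by (auto simp: S.cycle_def S.awalk_def)
  ultimately have arcs: "set p \<subseteq> E \<union> E\<inverse>" by blast
  have path: "S.apath b es a"
    using cyc by (auto simp: S.cycle_def p S.apath_def S.awalk_Cons_iff)
  have "length es \<noteq> 1" "es \<noteq> []" using len by (auto simp: p)
  moreover have "a \<notin> fst ` set es"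
  proof -
    have "S.awlast b es = a" using path by (auto simp: S.apath_def)
    then show ?thesis
      using path \<open>es \<noteq> []\<close> by (auto simp: S.apath_def S.awalk_verts_conv)
  qed
  moreover have "(b, a) \<notin> set es"
  proof (cases es)
    case (Cons e es')
    have "e \<noteq> (b, a)"
    proof
      assume "e = (b, a)"
      then have "S.apath a es' a" using path by (simp add: Cons S.apath_Cons_iff)
      moreover have "es' \<noteq> []" using \<open>length es \<noteq> 1\<close> by (auto simp: Cons)
      ultimately show False using S.apath_nonempty_ends by blast
    qed
    moreover have "b \<notin> fst ` set es'"
      using path S.awalk_verts_arc1 by (fastforce simp: Cons S.apath_Cons_iff)
    ultimately show ?thesis by (force simp: Cons)
  qed simp
  ultimately have "(a, b) \<notin> set es" "(b, a) \<notin> set es" by force+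
  then have es: "set es \<subseteq> (E - {e}) \<union> (E - {e})\<inverse>" if "e = (a, b) \<or> e = (b, a)" for e
    using arcs that by (auto simp: p)
  have "(b, a) \<in> linked (E - {e})" if "e = (a, b) \<or> e = (b, a)" for e
    unfolding linked_def
    using cas_with_proj_rtrancl[OF _ es[OF that]] path by (auto simp: S.apath_def)
  moreover from this have "(a, b) \<in> linked (E - {e})" if "e = (a, b) \<or> e = (b, a)" for e
    using that linked_sym by metis
  moreover have "(a, b) \<in> E \<or> (b, a) \<in> E" using arcs by (auto simp: p)
  ultimately show thesis using that by blast
qed

section \<open>Homogeneous solutions supported on a basis\<close>

lemma lp_basis_kernel:
  assumes "lp_basis P B" "finite (lp_vars P)"
    and eq: "\<And>i. i \<in> lp_rows P \<Longrightarrow> (\<Sum>j\<in>lp_vars P. lp_coef P i j * z j) = 0"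
    and nonbasic: "\<And>j. j \<in> lp_vars P - B \<Longrightarrow> z j = 0"
  shows "j \<in> lp_vars P \<Longrightarrow> z j = 0"
proof -
  have B: "B \<subseteq> lp_vars P" "finite B"
    using assms(1,2) by (auto simp: lp_basis_def intro: finite_subset)
  have "(\<Sum>j\<in>B. z j * lp_coef P i j) = 0" if "i \<in> lp_rows P" for i
    using eq[OF that] sum.mono_neutral_left[OF assms(2) B(1), of "\<lambda>j. z j * lp_coef P i j"] nonbasic
    by (simp add: mult.commute)
  then have "\<forall>j\<in>B. z j = 0"
    using assms(1) lp_columns_independent_iff[OF B(2), of P] unfolding lp_basis_def by blast
  then show "j \<in> lp_vars P \<Longrightarrow> z j = 0" using nonbasic by blast
qed

section \<open>The basis of the linear program of a graph\<close>

lemma nonbasic_graph_subset: "parcs (nonbasic_graph G B) \<subseteq> parcs G"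
  by (auto simp: nonbasic_graph_def nonbasic_pos_def)

lemma simple_digraph_arcs:
  assumes "simple_digraph G"
  shows "parcs G \<subseteq> pverts G \<times> pverts G"
proof -
  interpret pair_digraph G using assms by (simp add: simple_digraph_def)
  show ?thesis using wellformed by fastforce
qed

lemma simple_digraph_finite:
  assumes "simple_digraph G"
  shows "finite (pverts G)" "finite (parcs G)"
proof -
  interpret pair_digraph G using assms by (simp add: simple_digraph_def)
  show "finite (pverts G)" "finite (parcs G)" by (simp_all add: pair_finite_verts pair_finite_arcs)
qed

lemma finite_flow_vars:
  assumes "simple_digraph G"
  shows "finite (lp_vars (flow_lp G c h \<Delta> d))"
  using card_flow_lp(2)[OF assms] by (metis Suc_eq_plus1 card.infinite nat.distinct(1))

lemma nonbasic_class_subset: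
  assumes "simple_digraph G" "S \<in> pverts G // linked (parcs (nonbasic_graph G B))"
  shows "S \<subseteq> pverts G"
  using simple_digraph_arcs[OF assms(1)] nonbasic_graph_subset linked_class_subset[OF _ assms(2)]
  by blast

lemma flow_basis_kernel:
  assumes "simple_digraph G" "lp_basis (flow_lp G c h \<Delta> d) B"
    and "lp_equations (flow_lp G c h 0 d) (case_flow_var x a s)"
    and "\<And>v. XVar v \<notin> B \<Longrightarrow> x v = 0" "\<And>u v. AVar u v \<notin> B \<Longrightarrow> a u v = 0" "SVar \<notin> B \<Longrightarrow> s = 0"
    and "j \<in> lp_vars (flow_lp G c h \<Delta> d)"
  shows "case_flow_var x a s j = 0"
proof (rule lp_basis_kernel[OF assms(2) finite_flow_vars[OF assms(1)] _ _ assms(7)])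
  show "case_flow_var x a s k = 0" if "k \<in> lp_vars (flow_lp G c h \<Delta> d) - B" for k
    using that assms(4-6) by (cases k) auto
  show "(\<Sum>k\<in>lp_vars (flow_lp G c h \<Delta> d). lp_coef (flow_lp G c h \<Delta> d) i k * case_flow_var x a s k) = 0"
    if "i \<in> lp_rows (flow_lp G c h \<Delta> d)" for i
    using that assms(3) by (auto simp: lp_equations_def flow_lp_def split: flow_row.splits)
qed

lemma flow_basis_edge:
  assumes G: "simple_digraph G" and B: "lp_basis (flow_lp G c h \<Delta> d) B" and uv: "(u, v) \<in> parcs G"
  shows "AVar u v \<notin> B \<or> AVar v u \<notin> B"
proof (rule ccontr)
  assume "\<not> ?thesis"
  then have both: "AVar u v \<in> B" "AVar v u \<in> B" by simp_all
  let ?a = "\<lambda>p q. if p = u \<and> q = v \<or> p = v \<and> q = u then 1 else 0 :: real"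
  have "lp_equations (flow_lp G c h 0 d) (case_flow_var (\<lambda>_. 0) ?a 0)"
    by (auto simp: lp_equations_flow_lp[OF G])
  from flow_basis_kernel[OF G B this, of "AVar u v"] have "?a u v = 0"
    using both uv by (fastforce simp: flow_lp_def)
  then show False by simp
qed

lemma flow_basis_nonbasic_arcs:
  assumes "simple_digraph G" "lp_basis (flow_lp G c h \<Delta> d) B"
  shows "nonbasic_pos G B \<union> nonbasic_neg G B = parcs G"
  using flow_basis_edge[OF assms] by (auto simp: nonbasic_pos_def nonbasic_neg_def)

text \<open>
  Such an \<open>x\<close> extends to a homogeneous solution. On an edge of \<^const>\<open>nonbasic_graph\<close> both
  arc variables have to vanish, which is consistent because \<open>x\<close> agrees at its ends; on every
  other edge the single basic variable takes up the difference of \<open>x\<close>. Likewise a basic slack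
  variable takes up the sum in the budget row.
\<close>

lemma flow_basis_potential:
  assumes G: "simple_digraph G" and B: "lp_basis (flow_lp G c h \<Delta> d) B"
    and const: "\<And>u v. (u, v) \<in> parcs (nonbasic_graph G B) \<Longrightarrow> x u = x v"
    and nonbasic: "\<And>v. v \<in> nonbasic_verts G B \<Longrightarrow> x v = 0"
    and budget: "SVar \<notin> B \<Longrightarrow> (\<Sum>v\<in>pverts G. h v * x v) = 0"
    and v: "v \<in> pverts G"
  shows "x v = 0"
proof -
  \<comment> \<open>\<open>x\<close> is arbitrary outside the graph, whereas every \<open>XVar w\<close> outside \<open>B\<close> has to be zero.\<close>
  define y where "y w = (if w \<in> pverts G then x w else 0)" for w
  define a where "a p q = (if AVar p q \<in> B then y p - y q else 0)" for p q
  have "y p - y q = a p q - a q p" if pq: "(p, q) \<in> parcs G" for p q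
    using flow_basis_edge[OF G B pq] const[of p q] simple_digraph_arcs[OF G] pq
    by (auto simp: a_def y_def nonbasic_graph_def nonbasic_pos_def nonbasic_neg_def)
  moreover have "(\<Sum>v\<in>pverts G. h v * y v) = (\<Sum>v\<in>pverts G. h v * x v)"
    by (rule sum.cong) (simp_all add: y_def)
  ultimately have "lp_equations (flow_lp G c h 0 d) (case_flow_var y a (- (\<Sum>v\<in>pverts G. h v * x v)))"
    by (auto simp: lp_equations_flow_lp[OF G])
  from flow_basis_kernel[OF G B this, of "XVar v"] have "y v = 0"
    using nonbasic budget v by (auto simp: flow_lp_def y_def a_def nonbasic_verts_def)
  then show ?thesis using v by (simp add: y_def)
qed

text \<open>
  The number of basic variables, counted by their kinds: an edge contributes one unless it
  belongs to \<^const>\<open>nonbasic_graph\<close>.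
\<close>

lemma flow_basis_card:
  assumes G: "simple_digraph G" and B: "lp_basis (flow_lp G c h \<Delta> d) B"
  shows "card (pverts G) + of_bool (SVar \<in> B)
    = card (nonbasic_verts G B) + card (parcs (nonbasic_graph G B)) + 1"
proof -
  let ?P = "flow_lp G c h \<Delta> d" and ?N = "parcs (nonbasic_graph G B)"
  note fin = simple_digraph_finite[OF G]
  have "real (card B) = (\<Sum>j\<in>lp_vars ?P. of_bool (j \<in> B))"
    using B finite_flow_vars[OF G, of c h \<Delta> d]
    by (simp add: lp_basis_def Int_absorb1 flip: sum.inter_filter)
  also have "\<dots> = (\<Sum>v\<in>pverts G. of_bool (XVar v \<in> B))
      + (\<Sum>(u, v)\<in>parcs G. of_bool (AVar u v \<in> B) + of_bool (AVar v u \<in> B)) + of_bool (SVar \<in> B)"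
    by (rule sum_flow_vars[OF G])
  also have "(\<Sum>v\<in>pverts G. of_bool (XVar v \<in> B))
      = (\<Sum>v\<in>pverts G. 1 - of_bool (v \<in> nonbasic_verts G B) :: real)"
    by (rule sum.cong) (auto simp: nonbasic_verts_def)
  also have "\<dots> = real (card (pverts G)) - card (nonbasic_verts G B)"
    using fin by (simp add: sum_subtractf nonbasic_verts_def Int_def)
  also have "(\<Sum>(u, v)\<in>parcs G. of_bool (AVar u v \<in> B) + of_bool (AVar v u \<in> B))
      = (\<Sum>e\<in>parcs G. 1 - of_bool (e \<in> ?N) :: real)"
    by (rule sum.cong) (use flow_basis_edge[OF G B] in
      \<open>auto simp: nonbasic_graph_def nonbasic_pos_def nonbasic_neg_def\<close>)
  also have "\<dots> = real (card (parcs G)) - card ?N"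
    using fin nonbasic_graph_subset[of G B] by (simp add: sum_subtractf Int_absorb1)
  finally have "real (card B) = real (card (pverts G)) - card (nonbasic_verts G B)
    + (real (card (parcs G)) - card ?N) + of_bool (SVar \<in> B)" .
  moreover have "card B = card (parcs G) + 1"
    using B card_flow_lp(1)[OF G] by (simp add: lp_basis_def)
  ultimately have "real (card (pverts G) + of_bool (SVar \<in> B)) 
      = real (card (nonbasic_verts G B) + card ?N + 1)"
    by (simp add: algebra_simps)
  then show ?thesis by (simp only: of_nat_eq_iff)
qed

text \<open>
  The potential that is one on \<open>S\<close> and zero elsewhere would violate
  \<open>flow_basis_potential\<close> if the slack variable could balance the budget row.
\<close>

lemma flow_basis_free_class:
  assumes G: "simple_digraph G" and B: "lp_basis (flow_lp G c h \<Delta> d) B"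
    and S: "S \<in> pverts G // linked (parcs (nonbasic_graph G B))" "nonbasic_verts G B \<inter> S = {}"
  shows "SVar \<notin> B"
proof
  assume s: "SVar \<in> B"
  obtain v where v: "v \<in> S" using linked_class_nonempty[OF S(1)] by blast
  have "of_bool (v \<in> S) = (0 :: real)"
    by (rule flow_basis_potential[OF G B])
      (use S s v nonbasic_class_subset[OF G S(1)] linked_class_closed[OF S(1)] in auto)
  with v show False by simp
qed

text \<open>
  Without the slack variable the budget row has to balance by itself. On two classes the
  values \<open>h(T)\<close> and \<open>- h(S)\<close> achieve this, and they are nonzero by positivity of \<open>h\<close>.
\<close>

lemma flow_basis_free_classes_eq:
  assumes G: "simple_digraph G" and h: "\<forall>v\<in>pverts G. 0 < h v"
    and B: "lp_basis (flow_lp G c h \<Delta> d) B"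
    and S: "S \<in> pverts G // linked (parcs (nonbasic_graph G B))" "nonbasic_verts G B \<inter> S = {}"
    and T: "T \<in> pverts G // linked (parcs (nonbasic_graph G B))" "nonbasic_verts G B \<inter> T = {}"
  shows "S = T"
proof (rule ccontr)
  assume "S \<noteq> T"
  note fin = simple_digraph_finite(1)[OF G]
  note sub = nonbasic_class_subset[OF G S(1)] nonbasic_class_subset[OF G T(1)]
  from \<open>S \<noteq> T\<close> have disj: "S \<inter> T = {}" using linked_classes_disjoint S(1) T(1) by blast
  obtain v where v: "v \<in> S" using linked_class_nonempty[OF S(1)] by blast
  define x where "x w = sum h T * of_bool (w \<in> S) - sum h S * of_bool (w \<in> T)" for w
  have ind: "(\<Sum>w\<in>pverts G. h w * of_bool (w \<in> U)) = sum h U" if "U \<subseteq> pverts G" for U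
    using fin that
    by (simp add: of_bool_def if_distrib[of "\<lambda>c. _ * c"] Int_absorb1 flip: sum.inter_restrict cong: if_cong)
  have "(\<Sum>w\<in>pverts G. h w * x w)
      = sum h T * (\<Sum>w\<in>pverts G. h w * of_bool (w \<in> S)) - sum h S * (\<Sum>w\<in>pverts G. h w * of_bool (w \<in> T))"
    unfolding x_def sum_distrib_left sum_subtractf[symmetric]
    by (rule sum.cong) (simp_all add: algebra_simps)
  then have budget: "(\<Sum>w\<in>pverts G. h w * x w) = 0" using ind sub by simp
  have "x v = 0"
  proof (rule flow_basis_potential[OF G B _ _ budget])
    show "x p = x q" if "(p, q) \<in> parcs (nonbasic_graph G B)" for p q
      using linked_class_closed[OF S(1) that] linked_class_closed[OF T(1) that]
      by (simp add: x_def)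
    show "x w = 0" if "w \<in> nonbasic_verts G B" for w
      using that S(2) T(2) by (auto simp: x_def)
    show "v \<in> pverts G" using v sub by blast
  qed
  moreover have "sum h T > 0"
    using h sub(2) linked_class_nonempty[OF T(1)] fin by (intro sum_pos) (auto intro: finite_subset)
  moreover have "x v = sum h T" using v disj by (auto simp: x_def)
  ultimately show False by simp
qed

lemma eq_1_if_sum_le_card:
  fixes f :: "'a \<Rightarrow> nat"
  assumes "finite R" "\<And>y. y \<in> R \<Longrightarrow> f y \<noteq> 0" "sum f R \<le> card R" "x \<in> R"
  shows "f x = 1"
proof (rule ccontr)
  assume "f x \<noteq> 1"
  with assms(2)[OF assms(4)] have "1 < f x" by simp
  then have "(\<Sum>y\<in>R. 1) < sum f R"
    using assms by (intro sum_strict_mono_ex1) (auto simp: Suc_le_eq)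
  with assms(3) show False by simp
qed

theorem proposition1:
  fixes G :: "'v pair_pre_digraph"
    and c h x :: "'v \<Rightarrow> real"
    and d a :: "'v \<Rightarrow> 'v \<Rightarrow> real"
    and \<Delta> s :: real
    and B :: "'v flow_var set"
  assumes "simple_digraph G"
    and "\<forall>v\<in>pverts G. 0 < h v"
    and "\<forall>(u, v)\<in>parcs G. 0 \<le> d u v + d v u"
    and "lp_basic_solution (flow_lp G c h \<Delta> d) B (case_flow_var x a s)"
  shows "nonbasic_pos G B \<union> nonbasic_neg G B = parcs G
    \<and> (SVar \<in> B \<longrightarrow>
        (\<forall>C\<in>components (nonbasic_graph G B). card (nonbasic_verts G B \<inter> verts C) = 1))
    \<and> (SVar \<notin> B \<longrightarrow>
        (\<exists>C\<in>components (nonbasic_graph G B).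
            card (nonbasic_verts G B \<inter> verts C) = 0 \<and> (\<Sum>v\<in>verts C. h v) \<noteq> 0 \<and>
            (\<forall>D\<in>components (nonbasic_graph G B) - {C}.
                card (nonbasic_verts G B \<inter> verts D) = 1)))
    \<and> (\<forall>C\<in>components (nonbasic_graph G B). undirected_tree C)"
proof -
  note G = assms(1) and h = assms(2)
  have B: "lp_basis (flow_lp G c h \<Delta> d) B" using assms(4) by (simp add: lp_basic_solution_def)
  let ?N = "nonbasic_graph G B"
  let ?E = "parcs ?N" and ?X = "nonbasic_verts G B"
  let ?Q = "pverts G // linked ?E"
  have N: "pverts ?N = pverts G" "?E \<subseteq> parcs G"
    using nonbasic_graph_subset by (auto simp: nonbasic_graph_def)
  have E: "?E \<subseteq> pverts G \<times> pverts G" using N(2) simple_digraph_arcs[OF G] by blast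
  have wf: "pair_wf_digraph ?N" by unfold_locales (use E N(1) in auto)
  have finV: "finite (pverts G)" and finE: "finite ?E"
    using simple_digraph_finite[OF G] N(2) by (auto intro: finite_subset)
  have finQ: "finite ?Q" using finV by (simp add: quotient_def)
  have sub: "S \<subseteq> pverts G" "finite S" if "S \<in> ?Q" for S
    using nonbasic_class_subset[OF G that] finV finite_subset by blast+
  have components: "components ?N = (\<lambda>S. with_proj ?N \<restriction> S) ` ?Q"
    using components_conv_linked_classes[OF wf] by (simp add: N(1))
  have X: "?X \<subseteq> pverts G" by (auto simp: nonbasic_verts_def)
  have card_X: "card ?X = (\<Sum>S\<in>?Q. card (?X \<inter> S))"
  proof -
    have "?X = (\<Union>S\<in>?Q. ?X \<inter> S)"
    proof
      show "?X \<subseteq> (\<Union>S\<in>?Q. ?X \<inter> S)"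
      proof
        fix v assume "v \<in> ?X"
        then have "linked ?E `` {v} \<in> ?Q" "v \<in> ?X \<inter> linked ?E `` {v}"
          using X by (auto intro: quotientI linked_refl)
        then show "v \<in> (\<Union>S\<in>?Q. ?X \<inter> S)" by blast
      qed
    qed blast
    also have "card \<dots> = (\<Sum>S\<in>?Q. card (?X \<inter> S))"
    proof (rule card_UN_disjoint[OF finQ])
      show "\<forall>S\<in>?Q. finite (?X \<inter> S)" using sub(2) by simp
      show "\<forall>S\<in>?Q. \<forall>T\<in>?Q. S \<noteq> T \<longrightarrow> ?X \<inter> S \<inter> (?X \<inter> T) = {}"
        using linked_classes_disjoint by blast
    qed
    finally show ?thesis .
  qed
  have count: "card (pverts G) + of_bool (SVar \<in> B) = card ?X + card ?E + 1"
    by (rule flow_basis_card[OF G B])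
  have bound: "card (pverts G) \<le> card ?Q + card ?E"
    by (rule card_le_linked_classes_plus_arcs[OF finV finE])
  have free: "SVar \<notin> B" if "S \<in> ?Q" "card (?X \<inter> S) = 0" for S
    using that sub by (intro flow_basis_free_class[OF G B that(1)]) auto
  have free_eq: "S = T" if "S \<in> ?Q" "card (?X \<inter> S) = 0" "T \<in> ?Q" "card (?X \<inter> T) = 0" for S T
    using that sub by (intro flow_basis_free_classes_eq[OF G h B that(1) _ that(3)]) auto
  have eq1: "card (?X \<inter> S) = 1"
    if "R \<subseteq> ?Q" "\<And>S. S \<in> R \<Longrightarrow> card (?X \<inter> S) \<noteq> 0"
      "(\<Sum>S\<in>R. card (?X \<inter> S)) \<le> card R" "S \<in> R" for R S
    using eq_1_if_sum_le_card[of R "\<lambda>S. card (?X \<inter> S)"] that finQ finite_subset by blast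
  have basic: "\<forall>S\<in>?Q. card (?X \<inter> S) = 1" if s: "SVar \<in> B"
    using eq1[of ?Q] free s count bound card_X by auto
  have nonbasic: "\<exists>S\<in>?Q. card (?X \<inter> S) = 0 \<and> (\<forall>T\<in>?Q - {S}. card (?X \<inter> T) = 1)"
    if s: "SVar \<notin> B"
  proof -
    have le: "(\<Sum>S\<in>?Q. card (?X \<inter> S)) + 1 \<le> card ?Q"
      using count bound card_X s by simp
    have "\<exists>S\<in>?Q. card (?X \<inter> S) = 0"
    proof (rule ccontr)
      assume "\<not> ?thesis"
      then have "(\<Sum>S\<in>?Q. 1) \<le> (\<Sum>S\<in>?Q. card (?X \<inter> S))"
        by (intro sum_mono) (simp add: Suc_le_eq)
      with le show False by simp
    qed
    then obtain S where S: "S \<in> ?Q" "card (?X \<inter> S) = 0" by blast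
    have "(\<Sum>T\<in>?Q - {S}. card (?X \<inter> T)) \<le> card (?Q - {S})"
      using le S finQ by (simp add: sum_diff1_nat)
    then show ?thesis using S eq1[of "?Q - {S}"] free_eq by blast
  qed
  \<comment> \<open>Equality in this bound leaves no room for a redundant arc, hence for a cycle.\<close>
  have tight: "card (pverts G) = card ?Q + card ?E"
  proof (cases "SVar \<in> B")
    case True
    then show ?thesis using basic count card_X by simp
  next
    case False
    then obtain S where S: "S \<in> ?Q" "card (?X \<inter> S) = 0" "\<forall>T\<in>?Q - {S}. card (?X \<inter> T) = 1"
      using nonbasic by blast
    then have "card ?X = card (?Q - {S})"
      using card_X sum.remove[OF finQ S(1), of "\<lambda>S. card (?X \<inter> S)"] by simp
    moreover have "card ?Q = Suc (card (?Q - {S}))" by (rule card.remove[OF finQ S(1)])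
    ultimately show ?thesis using count False by simp
  qed
  have tree: "undirected_tree (with_proj ?N \<restriction> S)" if S: "S \<in> ?Q" for S
    unfolding undirected_tree_def
  proof (intro conjI notI)
    let ?H = "with_proj ?N \<restriction> S"
    show "connected ?H" using connected_induce_linked_class[OF wf] S N(1) by simp
    assume "\<exists>p. pre_digraph.cycle (with_proj (mk_symmetric ?H)) p \<and> 3 \<le> length p"
    then obtain p where p: "pre_digraph.cycle (with_proj (mk_symmetric ?H)) p" "3 \<le> length p" by blast
    have "wf_digraph ?H" by unfold_locales auto
    moreover have "arcs_ends ?H \<subseteq> ?E" by (auto simp: arcs_ends_conv)
    ultimately obtain u v where "(u, v) \<in> ?E" "(u, v) \<in> linked (?E - {(u, v)})"
      using cycle_imp_redundant_arc p by blast
    then have "card (pverts G) < card ?Q + card ?E"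
      by (rule card_less_if_redundant_arc[OF finV finE])
    with tight show False by simp
  qed
  have pos: "(\<Sum>v\<in>S. h v) \<noteq> 0" if "S \<in> ?Q" for S
    using sum_pos[of S h] sub[OF that] linked_class_nonempty[OF that] h by fastforce
  show ?thesis
  proof (intro conjI impI)
    show "nonbasic_pos G B \<union> nonbasic_neg G B = parcs G"
      by (rule flow_basis_nonbasic_arcs[OF G B])
    show "\<forall>C\<in>components ?N. card (?X \<inter> verts C) = 1" if "SVar \<in> B"
      using basic[OF that] by (simp add: components)
    show "\<forall>C\<in>components ?N. undirected_tree C"
      using tree by (simp add: components)
    assume "SVar \<notin> B"
    then obtain S where S: "S \<in> ?Q" "card (?X \<inter> S) = 0" "\<forall>T\<in>?Q - {S}. card (?X \<inter> T) = 1"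
      using nonbasic by blast
    then show "\<exists>C\<in>components ?N. card (?X \<inter> verts C) = 0 \<and> (\<Sum>v\<in>verts C. h v) \<noteq> 0
        \<and> (\<forall>D\<in>components ?N - {C}. card (?X \<inter> verts D) = 1)"
      unfolding components using pos[OF S(1)] by (intro bexI[of _ "with_proj ?N \<restriction> S"]) auto
  qed
qed

end
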